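(* For each $n\in\mathbb{N}$ let $x_n$ be the positive real root of the equation $z^{n+1}=(1+z)^n$. Then the sequence $\{x_n\}_{n\in\mathbb{N}}$ is strictly increasing.
   Context: $\mathbb{N}=\{1,2,3,\dots\}$. For each $n\in\mathbb{N}$ the equation $z^{n+1}=(1+z)^n$ has exactly one positive real root, so $x_n$ is well defined. *)

theory Defs
  imports Complex_Main
begin

definition pos_root :: "nat \<Rightarrow> real" where
  "pos_root n = (THE z. z > 0 \<and> z ^ (n + 1) = (1 + z) ^ n)"

text \<open>The description in \<^const>\<open>pos_root\<close> is proper.\<close>

lemma pos_root_ex1: "\<exists>!z::real. z > 0 \<and> z ^ (n + 1) = (1 + z) ^ n"
proof (rule ex_ex1I)
  let ?f = "\<lambda>z::real. z ^ (n + 1) - (1 + z) ^ n"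
  have "(1 + 2 ^ n) ^ n \<le> (2 * 2 ^ n :: real) ^ n"
    by (rule power_mono) auto
  also have "\<dots> = (2 ^ n) ^ (n + 1)"
    by (simp add: power_mult_distrib)
  finally have "?f 0 \<le> 0" "0 \<le> ?f (2 ^ n)"
    by auto
  moreover have "continuous_on {0..2 ^ n} ?f"
    by (intro continuous_intros)
  ultimately obtain z where "0 \<le> z" "?f z = 0"
    using IVT'[of ?f 0 0 "2 ^ n"] by auto
  moreover from this have "z \<noteq> 0" by (intro notI) simp
  ultimately show "\<exists>z::real. z > 0 \<and> z ^ (n + 1) = (1 + z) ^ n"
    by (intro exI[of _ z]) auto
next
  have less: False
    if "0 < a" "a < b" "a ^ (n + 1) = (1 + a) ^ n" "b ^ (n + 1) = (1 + b) ^ n" for a b :: real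
  proof -
    have q: "z * (z / (1 + z)) ^ n = 1" if "0 < z" "z ^ (n + 1) = (1 + z) ^ n" for z :: real
      using that by (simp add: power_divide)
    have "a / (1 + a) \<le> b / (1 + b)"
      using that by (simp add: field_simps)
    then have "(a / (1 + a)) ^ n \<le> (b / (1 + b)) ^ n"
      using that by (intro power_mono) auto
    moreover have "0 < (a / (1 + a)) ^ n"
      using that by simp
    ultimately have "a * (a / (1 + a)) ^ n < b * (b / (1 + b)) ^ n"
      using that by (intro mult_less_le_imp_less) auto
    with q[of a] q[of b] that show False by simp
  qed
  show "z = w" if "z > 0 \<and> z ^ (n + 1) = (1 + z) ^ n" "w > 0 \<and> w ^ (n + 1) = (1 + w) ^ n"
    for z w :: real
    using less[of z w] less[of w z] that by (cases z w rule: linorder_cases) auto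
qed

end

theory Submission
  imports Defs
begin

text \<open>Writing the equation as \<open>z * (z / (1 + z)) ^ n = 1\<close>, the left-hand side increases in
  \<open>z > 0\<close> and, since \<open>0 < z / (1 + z) < 1\<close>, decreases in \<open>n\<close>.\<close>

lemma pos_root_pos: "0 < pos_root n"
  and pos_root_eq: "pos_root n ^ (n + 1) = (1 + pos_root n) ^ n"
  using theI'[OF pos_root_ex1[of n]] unfolding pos_root_def by auto

text \<open>The defining equation divided by the positive number
  \<open>(1 + pos_root n) ^ n\<close>.\<close>

lemma pos_root_normal_form: "pos_root n * (pos_root n / (1 + pos_root n)) ^ n = 1"
  using pos_root_pos[of n] pos_root_eq[of n] by (simp add: power_divide)

text \<open>If the root failed to grow from \<open>m\<close> to \<open>n\<close>, the two
  monotonicities would chain to \<open>1 < 1\<close>. Index 0 is included, where the root is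
  1.\<close>

lemma strict_mono_pos_root: "strict_mono pos_root"
proof (rule strict_monoI, rule ccontr)
  fix m n :: nat
  assume "m < n" and "\<not> pos_root m < pos_root n"
  define x y where "x = pos_root m" and "y = pos_root n"
  have pos: "0 < x" "0 < y" and le: "y \<le> x"
    using \<open>\<not> pos_root m < pos_root n\<close> by (auto simp: x_def y_def pos_root_pos)
  have "1 = y * (y / (1 + y)) ^ n"
    by (simp add: y_def pos_root_normal_form)
  \<comment> \<open>Strict because \<open>0 < y / (1 + y) < 1\<close> and the exponent
    drops.\<close>
  also have "\<dots> < y * (y / (1 + y)) ^ m"
    using pos \<open>m < n\<close> by (intro mult_strict_left_mono power_strict_decreasing) auto
  \<comment> \<open>With the exponent fixed, both \<open>z\<close> and \<open>z / (1 + z)\<close>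
    increase in \<open>z > 0\<close>.\<close>
  also have "\<dots> \<le> x * (x / (1 + x)) ^ m"
    using pos le by (intro mult_mono power_mono) (auto simp: field_simps)
  also have "\<dots> = 1"
    by (simp add: x_def pos_root_normal_form)
  finally show False by simp
qed

theorem theorem2p3: "strict_mono_on {1..} pos_root"
  using strict_mono_pos_root by (auto simp: strict_mono_on_def strict_mono_def)

end
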